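(* Let $a,b,c$ be nonzero real numbers, let $w_0,w_1$ be arbitrary real initial values, let $\{w_n\}$ be the associated generalized bi-periodic Horadam sequence and $\{u_n\}$ the generalized bi-periodic Fibonacci sequence. Then for any positive integers $n,p,q$, $$\left(\frac ba\right)^{\zeta(n)\zeta(p)\zeta(q)}w_{n+p}w_{n+q}-\left(\frac ba\right)^{\zeta(n+1)\zeta(p)\zeta(q)}w_n w_{n+p+q}$$ $$=\left(\frac ba\right)^{\zeta(n)\zeta(p+1)\zeta(q+1)}(-c)^n u_p u_q\left(w_1^2-b\,w_0w_1-\frac ba\,c\,w_0^2\right).$$
   Context: For nonzero real numbers $a,b,c$ and real initial values $w_0,w_1$, the generalized bi-periodic Horadam sequence $\{w_n\}$ is defined by $w_n=\chi(n)w_{n-1}+c\,w_{n-2}$ for $n\ge 2$, where $\chi(n)=a$ if $n$ is even and $\chi(n)=b$ if $n$ is odd. The generalized bi-periodic Fibonacci sequence $\{u_n\}$ satisfies the same recurrence (same $a,b,c$) with $u_0=0$, $u_1=1$. The parity function is $\zeta(n)=0$ if $n$ is even and $\zeta(n)=1$ if $n$ is odd. *)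

theory Defs
  imports Complex_Main
begin

definition bp_chi :: "real \<Rightarrow> real \<Rightarrow> nat \<Rightarrow> real" where
  "bp_chi a b n = (if even n then a else b)"

text \<open>The arguments \<open>x\<close> and \<open>y\<close> are the initial values at \<open>0\<close> and \<open>1\<close>.\<close>

fun horadam :: "real \<Rightarrow> real \<Rightarrow> real \<Rightarrow> real \<Rightarrow> real \<Rightarrow> nat \<Rightarrow> real" where
  "horadam a b c x y 0 = x"
| "horadam a b c x y (Suc 0) = y"
| "horadam a b c x y (Suc (Suc n)) =
     bp_chi a b (Suc (Suc n)) * horadam a b c x y (Suc n) + c * horadam a b c x y n"

definition bp_fib :: "real \<Rightarrow> real \<Rightarrow> real \<Rightarrow> nat \<Rightarrow> real" where
  "bp_fib a b c = horadam a b c 0 1"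

definition parity :: "nat \<Rightarrow> nat" where
  "parity n = (if even n then 0 else 1)"

end

(* The recurrence is invariant under an even shift, and an odd shift exchanges a and b. Hence the
   identity reduces to the case n = 0 for the initial values w(n), w(n+1): both sides then satisfy
   the recurrence in q, and their values at q = 1 satisfy it in p. The quadratic form on the right
   is multiplied by -c at each step of the shift, up to the factor b/a at odd n. *)
theory Submission
  imports Defs
begin

lemma parity_simps [simp]:
  "parity 0 = 0"
  "parity (Suc (Suc n)) = parity n"
  "even n \<Longrightarrow> parity n = 0"
  "odd n \<Longrightarrow> parity n = 1"
  by (auto simp: parity_def)

lemma horadam_even_shift:
  assumes "even n"
  shows "horadam a b c x y (n + p) = horadam a b c (horadam a b c x y n) (horadam a b c x y (Suc n)) p"
proof (induction p rule: induct_nat_012)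
  case (ge2 p)
  with assms show ?case by (simp add: bp_chi_def)
qed simp_all

lemma horadam_odd_shift:
  assumes "odd n"
  shows "horadam a b c x y (n + p) = horadam b a c (horadam a b c x y n) (horadam a b c x y (Suc n)) p"
proof (induction p rule: induct_nat_012)
  case (ge2 p)
  with assms show ?case by (simp add: bp_chi_def)
qed simp_all

text \<open>Odd-indexed terms are symmetric in \<open>a\<close> and \<open>b\<close>; even-indexed
  ones are \<open>a\<close> times a symmetric expression, so exchanging the parameters costs a
  factor \<open>b / a\<close>.\<close>

lemma bp_fib_swap:
  assumes "a \<noteq> 0" "b \<noteq> 0"
  shows "bp_fib b a c p = (b / a) ^ parity (Suc p) * bp_fib a b c p"
  unfolding bp_fib_def
proof (induction p rule: induct_nat_012)
  case (ge2 p)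
  then show ?case
    using assms by (cases "even p") (simp_all add: bp_chi_def field_simps)
qed simp_all

definition horadam_form :: "real \<Rightarrow> real \<Rightarrow> real \<Rightarrow> real \<Rightarrow> real \<Rightarrow> real" where
  "horadam_form a b c x y = y ^ 2 - b * x * y - (b / a) * c * x ^ 2"

text \<open>This is the case n = 0, q = 1. The shifted sequence obeys the recurrence with
  \<open>a\<close> and \<open>b\<close> exchanged; the weight \<open>(b / a) ^ parity p\<close>
  makes it a solution of the original one, so comparing p = 0 and p = 1 suffices.\<close>

lemma horadam_catalan_1:
  assumes "a \<noteq> 0"
  shows "horadam a b c x y p * y - (b / a) ^ parity p * x * horadam a b c x y (Suc p)
       = bp_fib a b c p * horadam_form a b c x y"
  unfolding bp_fib_def
proof (induction p rule: induct_nat_012)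
  case 1
  then show ?case
    using assms by (simp add: horadam_form_def bp_chi_def field_simps power2_eq_square)
next
  case (ge2 p)
  define h where "h = horadam a b c x y"
  define v where "v = horadam a b c 0 1"
  define K where "K = horadam_form a b c x y"
  have IH: "h p * y = v p * K + (b / a) ^ parity p * x * h (Suc p)"
    "h (Suc p) * y = v (Suc p) * K + (b / a) ^ parity (Suc p) * x * h (Suc (Suc p))"
    using ge2 unfolding h_def v_def K_def by (simp_all only: algebra_simps)
  have rec: "h (Suc (Suc m)) = bp_chi a b m * h (Suc m) + c * h m"
    "v (Suc (Suc m)) = bp_chi a b m * v (Suc m) + c * v m" for m
    by (simp_all add: h_def v_def bp_chi_def)
  have "h (Suc (Suc p)) * y = bp_chi a b p * (h (Suc p) * y) + c * (h p * y)"
    by (simp add: rec algebra_simps)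
  also have "\<dots> = v (Suc (Suc p)) * K
      + x * (bp_chi a b p * (b / a) ^ parity (Suc p) * h (Suc (Suc p)) + (b / a) ^ parity p * c * h (Suc p))"
    unfolding IH rec(2) by (simp only: algebra_simps)
  \<comment> \<open>The weight trades the coefficient at \<open>p\<close> for the one at
    \<open>Suc p\<close>: \<open>a * (b / a) = b\<close> for even \<open>p\<close>, and
    \<open>b = (b / a) * a\<close> for odd \<open>p\<close>.\<close>
  also have "bp_chi a b p * (b / a) ^ parity (Suc p) = (b / a) ^ parity p * bp_chi a b (Suc p)"
    using assms by (cases "even p") (simp_all add: bp_chi_def)
  finally show ?case
    by (simp add: h_def [symmetric] v_def [symmetric] K_def [symmetric] rec(1)[of "Suc p"] algebra_simps
        del: horadam.simps)
qed simp

text \<open>For q = 0 both sides vanish, and q = 1 is the previous lemma. A shift by odd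
  \<open>p\<close> exchanges the coefficients, which the weight corrects; for even \<open>p\<close>
  none is needed.\<close>

lemma horadam_catalan_0:
  assumes "a \<noteq> 0"
  shows "horadam a b c x y p * horadam a b c x y q
           - (b / a) ^ (parity p * parity q) * x * horadam a b c x y (p + q)
       = bp_fib a b c p * bp_fib a b c q * horadam_form a b c x y"
proof (induction q rule: induct_nat_012)
  case 0
  then show ?case by (simp add: bp_fib_def)
next
  case 1
  then show ?case
    using horadam_catalan_1[OF assms, of b c x y p] by (simp add: bp_fib_def)
next
  case (ge2 q)
  define h where "h = horadam a b c x y"
  define v where "v = bp_fib a b c"
  define K where "K = horadam_form a b c x y"
  define r where "r m = (b / a) ^ (parity p * parity m)" for m
  have IH: "h p * h q = v p * v q * K + r q * x * h (p + q)"
    "h p * h (Suc q) = v p * v (Suc q) * K + r (Suc q) * x * h (Suc (p + q))"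
    using ge2 unfolding h_def v_def K_def r_def add_Suc_right by (simp_all only: algebra_simps)
  have rec: "h (Suc (Suc m)) = bp_chi a b m * h (Suc m) + c * h m"
    "v (Suc (Suc m)) = bp_chi a b m * v (Suc m) + c * v m" for m
    by (simp_all add: h_def v_def bp_fib_def bp_chi_def)
  have "h p * h (Suc (Suc q)) = bp_chi a b q * (h p * h (Suc q)) + c * (h p * h q)"
    by (simp add: rec algebra_simps)
  also have "\<dots> = v p * v (Suc (Suc q)) * K
      + x * (bp_chi a b q * r (Suc q) * h (Suc (p + q)) + r q * c * h (p + q))"
    unfolding IH rec(2) by (simp only: algebra_simps)
  also have "bp_chi a b q * r (Suc q) = r q * bp_chi a b (p + q)"
    using assms by (cases "even p"; cases "even q") (simp_all add: bp_chi_def r_def)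
  also have "x * (r q * bp_chi a b (p + q) * h (Suc (p + q)) + r q * c * h (p + q))
      = r q * x * h (p + Suc (Suc q))"
    by (simp add: rec(1) algebra_simps)
  finally have "h p * h (Suc (Suc q)) = v p * v (Suc (Suc q)) * K + r q * x * h (p + Suc (Suc q))" .
  then show ?case
    unfolding h_def v_def K_def r_def parity_simps by (simp only: algebra_simps)
qed

text \<open>With \<open>z = a * y + c * x\<close>, the first two terms of the new form combine to
  \<open>z * (z - a * y) = c * x * z\<close>, which exposes the factor \<open>c\<close>; likewise
  with \<open>b\<close>.\<close>

lemma horadam_form_step:
  assumes "a \<noteq> 0" "b \<noteq> 0"
  shows "(b / a) * horadam_form b a c y (a * y + c * x) = - c * horadam_form a b c x y"
    and "horadam_form a b c y (b * y + c * x) = - c * ((b / a) * horadam_form b a c x y)"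
  using assms by (simp_all add: horadam_form_def field_simps power2_eq_square)

text \<open>The factor \<open>b / a\<close> in the odd branch makes every step, from either parity,
  multiply the value by exactly \<open>- c\<close>.\<close>

lemma horadam_form_shift:
  assumes "a \<noteq> 0" "b \<noteq> 0"
  shows "(if even n then horadam_form a b c (horadam a b c x y n) (horadam a b c x y (Suc n))
          else (b / a) * horadam_form b a c (horadam a b c x y n) (horadam a b c x y (Suc n)))
       = (- c) ^ n * horadam_form a b c x y"
proof (induction n)
  case (Suc n)
  then show ?case
    using horadam_form_step[OF assms, where c = c and y = "horadam a b c x y (Suc n)" and x = "horadam a b c x y n"]
    by (cases "even n") (simp_all add: bp_chi_def)
qed simp

theorem theorem4:
  fixes a b c w0 w1 :: real and w u :: "nat \<Rightarrow> real" and n p q :: nat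
  assumes "a \<noteq> 0" and "b \<noteq> 0" and "c \<noteq> 0"
    and w_def: "w = horadam a b c w0 w1"
    and u_def: "u = bp_fib a b c"
    and "n > 0" and "p > 0" and "q > 0"
  shows "(b / a) ^ (parity n * parity p * parity q) * w (n + p) * w (n + q)
           - (b / a) ^ (parity (n + 1) * parity p * parity q) * w n * w (n + p + q)
         = (b / a) ^ (parity n * parity (p + 1) * parity (q + 1)) * (- c) ^ n * u p * u q
             * (w1 ^ 2 - b * w0 * w1 - (b / a) * c * w0 ^ 2)"
proof -
  have form: "w1 ^ 2 - b * w0 * w1 - (b / a) * c * w0 ^ 2 = horadam_form a b c w0 w1"
    by (simp add: horadam_form_def)
  note shift = horadam_form_shift[OF assms(1,2), of n c w0 w1, folded w_def]
  show ?thesis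
  proof (cases "even n")
    case True
    have sh: "w (n + m) = horadam a b c (w n) (w (Suc n)) m" for m
      unfolding w_def by (rule horadam_even_shift[OF True])
    have "w (n + p) * w (n + q) - (b / a) ^ (parity p * parity q) * w n * w (n + (p + q))
        = u p * u q * horadam_form a b c (w n) (w (Suc n))"
      unfolding sh u_def by (rule horadam_catalan_0[OF assms(1)])
    then show ?thesis
      unfolding form using shift True by (simp add: add.assoc mult_ac)
  next
    case False
    \<comment> \<open>With the parameters exchanged the weight is a power of \<open>a / b\<close>;
      naming the ratio leaves a single nonzero quantity and its inverse.\<close>
    define r where "r = b / a"
    have r: "r \<noteq> 0" "a / b = inverse r"
      using assms by (simp_all add: r_def)
    have sh: "w (n + m) = horadam b a c (w n) (w (Suc n)) m" for m
      unfolding w_def by (rule horadam_odd_shift[OF False])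
    define F where "F = horadam_form b a c (w n) (w (Suc n))"
    have F: "r * F = (- c) ^ n * horadam_form a b c w0 w1"
      using shift False by (simp add: F_def r_def)
    have "w (n + p) * w (n + q) - inverse r ^ (parity p * parity q) * w n * w (n + (p + q))
        = bp_fib b a c p * bp_fib b a c q * F"
      unfolding sh F_def r(2)[symmetric] by (rule horadam_catalan_0[OF assms(2)])
    also have "\<dots> = r ^ parity (Suc p) * u p * (r ^ parity (Suc q) * u q) * F"
      by (simp only: bp_fib_swap[OF assms(1,2)] u_def r_def)
    \<comment> \<open>After multiplication by \<open>r ^ (parity p * parity q)\<close> the exponents
      on the right agree, since, writing z for \<open>parity\<close>, z(p) z(q) + z(p+1) + z(q+1) =
      z(p+1) z(q+1) + 1. The extra \<open>r\<close> completes \<open>r * F\<close>.\<close>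
    finally have "r ^ (parity p * parity q) * w (n + p) * w (n + q) - w n * w (n + (p + q))
        = r ^ (parity (Suc p) * parity (Suc q)) * u p * u q * (r * F)"
      using r(1) by (cases "even p"; cases "even q") (simp_all add: field_simps)
    then show ?thesis
      unfolding form F using False by (simp add: add.assoc mult_ac r_def)
  qed
qed

end
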